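(* Let $p$ be a prime and, for a nonzero integer $a$, let $v(a)$ denote the exponent of $p$ in the prime factorization of $a$. Let $f,g\in\mathbb{Z}[x]$ be monic polynomials with nonzero resultant $r$. Let $s$ be an integer with $0\le s\le p$ and assume that $p^s$ divides both $f(n)$ and $g(n)$ for all $n\in\mathbb{Z}$. Let $$S=\max_{n\in\mathbb{Z}} v(\gcd(f(n),g(n))).$$ Then: (a) $v(r)-S\ge ps^2-s$. (b) If $v(r)-S=ps^2-s$, then the function $n\mapsto v(\gcd(f(n),g(n)))$ on $\mathbb{Z}$ takes every integer value in the interval $[s,S]$.
   Context: The resultant of $f$ and $g$ is the determinant of their Sylvester matrix (equivalently $\prod_{i,j}(\gamma_i-\delta_j)$ over the roots $\gamma_i$ of $f$ and $\delta_j$ of $g$ counted with multiplicity). *)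

theory Defs
  imports Subresultants.Resultant_Prelim "HOL-Computational_Algebra.Computational_Algebra"
begin

definition gcd_val :: "nat \<Rightarrow> int poly \<Rightarrow> int poly \<Rightarrow> int \<Rightarrow> nat" where
  "gcd_val p f g n = multiplicity (int p) (gcd (poly f n) (poly g n))"

definition max_gcd_val :: "nat \<Rightarrow> int poly \<Rightarrow> int poly \<Rightarrow> nat" where
  "max_gcd_val p f g = Max (range (gcd_val p f g))"

text \<open>
  If the resultant is nonzero, every \<open>gcd (poly f n) (poly g n)\<close> divides it. Hence
  these gcds are nonzero, so that \<open>multiplicity\<close> is not applied to \<open>0\<close>, and \<open>gcd_val p f g\<close>
  has finite range, so that \<open>Max\<close> is a genuine maximum.
\<close>

lemma dvd_sylvester_mat_row:
  fixes f g :: "int poly" and x :: int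
  defines "N \<equiv> degree f + degree g"
  assumes i: "i < N"
  shows "gcd (poly f x) (poly g x) dvd
    (\<Sum>j<N. sylvester_mat f g $$ (i, j) * x ^ (N - 1 - j))"
proof (cases "i < degree g")
  case True
  have "(\<Sum>j<N. sylvester_mat f g $$ (i, j) * x ^ (N - 1 - j))
      = (\<Sum>j\<in>{i..i + degree f}. coeff f (degree f + i - j) * x ^ (N - 1 - j))"
    using True i by (intro sum.mono_neutral_cong_right) (auto simp: sylvester_index_mat N_def)
  also have "\<dots> = (\<Sum>k\<le>degree f. coeff f k * x ^ (k + (degree g - 1 - i)))"
    by (rule sum.reindex_bij_witness[where i = "\<lambda>k. degree f + i - k" and j = "\<lambda>j. degree f + i - j"])
       (use True in \<open>auto simp: N_def intro!: arg_cong[where f = "\<lambda>k. _ * x ^ k"]\<close>)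
  also have "\<dots> = poly f x * x ^ (degree g - 1 - i)"
    by (simp add: poly_altdef sum_distrib_right power_add mult.assoc)
  finally show ?thesis
    by simp
next
  case False
  have "(\<Sum>j<N. sylvester_mat f g $$ (i, j) * x ^ (N - 1 - j))
      = (\<Sum>j\<in>{i - degree g..i}. coeff g (i - j) * x ^ (N - 1 - j))"
    using False i by (intro sum.mono_neutral_cong_right) (auto simp: sylvester_index_mat N_def)
  also have "\<dots> = (\<Sum>k\<le>degree g. coeff g k * x ^ (k + (N - 1 - i)))"
    by (rule sum.reindex_bij_witness[where i = "\<lambda>k. i - k" and j = "\<lambda>j. i - j"])
       (use False i in \<open>auto simp: N_def intro!: arg_cong[where f = "\<lambda>k. _ * x ^ k"]\<close>)
  also have "\<dots> = poly g x * x ^ (N - 1 - i)"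
    by (simp add: poly_altdef sum_distrib_right power_add mult.assoc)
  finally show ?thesis
    by simp
qed

lemma gcd_poly_dvd_resultant:
  fixes f g :: "int poly" and x :: int
  assumes pos: "degree f + degree g > 0"
  shows "gcd (poly f x) (poly g x) dvd resultant f g"
proof -
  define N where "N = degree f + degree g"
  define A where "A = sylvester_mat f g"
  define v where "v = vec N (\<lambda>j. x ^ (N - 1 - j))"
  have A: "A \<in> carrier_mat N N" and v: "v \<in> carrier_vec N"
    by (auto simp: A_def N_def v_def)
  have B: "adj_mat A \<in> carrier_mat N N"
    using A by (rule adj_mat(1))
  have "adj_mat A *\<^sub>v (A *\<^sub>v v) = (adj_mat A * A) *\<^sub>v v"
    using A B v by simp
  also have "\<dots> = det A \<cdot>\<^sub>v v"
    using adj_mat(3)[OF A] v by (auto intro!: eq_vecI)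
  finally have "det A = (adj_mat A *\<^sub>v (A *\<^sub>v v)) $ (N - 1)"
    using pos by (simp add: v_def N_def)
  also have "\<dots> = (\<Sum>i<N. adj_mat A $$ (N - 1, i) * (\<Sum>j<N. A $$ (i, j) * x ^ (N - 1 - j)))"
    using A B pos by (auto simp: scalar_prod_def v_def N_def lessThan_atLeast0 intro!: sum.cong)
  also have "gcd (poly f x) (poly g x) dvd \<dots>"
    unfolding A_def N_def by (intro dvd_sum dvd_mult dvd_sylvester_mat_row) simp
  finally show ?thesis
    by (simp add: resultant_def A_def)
qed

lemma
  fixes f g :: "int poly"
  assumes lc: "lead_coeff f = 1" "lead_coeff g = 1" and r: "resultant f g \<noteq> 0"
  shows gcd_poly_nonzero: "gcd (poly f n) (poly g n) \<noteq> 0"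
    and finite_range_gcd_val: "finite (range (gcd_val p f g))"
proof -
  have dvd: "gcd (poly f n) (poly g n) dvd resultant f g" for n
  proof (cases "degree f + degree g > 0")
    case False
    then have "degree f = 0"
      by simp
    then have "f = 1"
      using lc(1) by (metis degree_0_id one_pCons lead_coeff_pCons(2) pCons_0_0 degree_eq_zeroE coeff_pCons_0)
    then show ?thesis
      by simp
  qed (rule gcd_poly_dvd_resultant)
  then show "gcd (poly f n) (poly g n) \<noteq> 0"
    using r by (metis dvd_0_left)
  have "range (gcd_val p f g) \<subseteq> multiplicity (int p) ` {d. d dvd resultant f g}"
    using dvd by (auto simp: gcd_val_def)
  moreover have "finite {d. d dvd resultant f g}"
    using r by (rule finite_divisors_int)
  ultimately show "finite (range (gcd_val p f g))"
    by (meson finite_imageI finite_subset)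
qed

end

theory Submission
  imports Defs
begin

text \<open>
  Write \<open>f\<close> and \<open>g\<close> in powers of \<open>x - a\<close>, for \<open>a\<close> in a complete residue system modulo \<open>p\<close>. Since
  \<open>s \<le> p\<close>, the coefficient of \<open>(x - a)^j\<close> is divisible by \<open>p^(s - j)\<close>, and the constant one by
  \<open>p^V(a)\<close>, where \<open>V(a)\<close> is the valuation of \<open>gcd (f(a)) (g(a))\<close>. So \<open>f\<close> and \<open>g\<close> lie in an ideal
  \<open>I\<close> of finite colength given by such exponents, and multiplying by elements of \<open>I\<close> lands in an ideal
  \<open>J\<close> with larger exponents. The rows of the Sylvester matrix are multiples of \<open>f\<close> and \<open>g\<close>; comparing
  determinants in triangular bases of \<open>I\<close> and \<open>J\<close> bounds \<open>v(r)\<close> from below by the colength of \<open>J\<close>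
  minus twice that of \<open>I\<close>, which gives \<open>v(r) \<ge> p s^2 + (\<Sum>a. V(a) - s)\<close> and hence (a).

  In the equality case \<open>V(a) = S\<close> for one residue class and \<open>V = s\<close> on the others. If a value \<open>t\<close> with
  \<open>s < t < S\<close> were omitted, looking at \<open>a + p^(t - s + 1)\<close> shows that the linear coefficients of both
  \<open>f\<close> and \<open>g\<close> at \<open>a\<close> are divisible by an additional factor \<open>p\<close>, which would improve the bound. (For
  \<open>s = 0\<close> the exponent is \<open>t\<close>.)
\<close>

subsection \<open>Triangular bases and the resultant\<close>

text \<open>Rows and columns run from high degree to low, the order of the Sylvester matrix, so the
  degree bound makes the matrix upper triangular.\<close>

lemma det_upper_triangular_reversed:
  fixes q :: "nat \<Rightarrow> 'a::comm_ring_1 poly"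
  assumes "\<And>k. k < n \<Longrightarrow> degree (q k) \<le> k"
  shows "det (mat n n (\<lambda>(i, j). coeff (q (n - 1 - i)) (n - 1 - j))) = (\<Prod>k<n. coeff (q k) k)"
proof -
  let ?M = "mat n n (\<lambda>(i, j). coeff (q (n - 1 - i)) (n - 1 - j))"
  have "upper_triangular ?M"
  proof (rule upper_triangularI)
    fix i j assume "j < i" "i < dim_row ?M"
    moreover from this have "degree (q (n - 1 - i)) < n - 1 - j"
      using assms[of "n - 1 - i"] by simp
    ultimately show "?M $$ (i, j) = 0"
      by (simp add: coeff_eq_0)
  qed
  then have "det ?M = prod_list (diag_mat ?M)"
    by (rule det_upper_triangular[where n = n]) simp
  also have "\<dots> = (\<Prod>i<n. coeff (q (n - 1 - i)) (n - 1 - i))"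
    by (simp add: prod_list_diag_prod atLeast0LessThan)
  also have "\<dots> = (\<Prod>k<n. coeff (q k) k)"
    by (rule prod.reindex_bij_witness[where i = "\<lambda>k. n - 1 - k" and j = "\<lambda>k. n - 1 - k"]) auto
  finally show ?thesis .
qed

text \<open>Reads the rows as shifts of \<open>f\<close> and \<open>g\<close>, so that products with
  the Sylvester matrix become products of polynomials.\<close>

lemma sylvester_mat_row_eq_coeff:
  fixes f g :: "'a::comm_ring_1 poly"
  assumes "i < degree f + degree g" "j < degree f + degree g"
  shows "sylvester_mat f g $$ (i, j) =
    coeff (if i < degree g then monom 1 (degree g - 1 - i) * f
           else monom 1 (degree f + degree g - 1 - i) * g) (degree f + degree g - 1 - j)"
  using assms
  by (auto simp: sylvester_index_mat coeff_monom_mult intro!: coeff_eq_0 arg_cong[where f = "coeff f"]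
    arg_cong[where f = "coeff g"])

lemma coeff_mult_eq_sum_monom:
  fixes a h :: "'a::comm_semiring_1 poly"
  assumes "degree a < n"
  shows "coeff (a * h) m = (\<Sum>i<n. coeff a i * coeff (monom 1 i * h) m)"
proof -
  have "a = (\<Sum>i<n. monom (coeff a i) i)"
    using assms by (subst poly_as_sum_of_monoms'[of a "n - 1", symmetric])
      (auto intro!: sum.cong)
  then have "a * h = (\<Sum>i<n. monom (coeff a i) i * h)"
    by (metis sum_distrib_right)
  then show ?thesis
    by (simp add: coeff_sum coeff_monom_mult if_distrib cong: if_cong)
qed

text \<open>
  With \<open>S\<close> the Sylvester matrix, the proof rests on an identity \<open>T * S = C * U\<close> in which both sides express
  the products \<open>a i * f\<close> and \<open>a i * g\<close> in the monomial basis, and \<open>T\<close> and \<open>U\<close> are triangular.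
\<close>

lemma prod_lead_dvd_resultant:
  fixes f g :: "'a::idom poly" and a u :: "nat \<Rightarrow> 'a poly"
  defines "N \<equiv> degree f + degree g"
  assumes deg_a: "\<And>i. i < N \<Longrightarrow> degree (a i) \<le> i" and deg_u: "\<And>k. k < N \<Longrightarrow> degree (u k) \<le> k"
    and span_f: "\<And>i. i < degree g \<Longrightarrow> \<exists>c. a i * f = (\<Sum>k<N. smult (c k) (u k))"
    and span_g: "\<And>i. i < degree f \<Longrightarrow> \<exists>c. a i * g = (\<Sum>k<N. smult (c k) (u k))"
  shows "(\<Prod>k<N. coeff (u k) k) dvd
    (\<Prod>i<degree g. coeff (a i) i) * (\<Prod>i<degree f. coeff (a i) i) * resultant f g"
proof -
  define d where "d = degree f"
  define e where "e = degree g"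
  have N: "N = e + d"
    by (simp add: N_def d_def e_def)
  \<comment> \<open>The products are listed with decreasing index in each block, as in the Sylvester
    matrix; in the second block \<open>N - 1 - i\<close> runs through the indices below
    \<open>d\<close>.\<close>
  define P where "P i = (if i < e then a (e - 1 - i) * f else a (N - 1 - i) * g)" for i
  have "\<exists>c. P i = (\<Sum>k<N. smult (c k) (u k))" if "i < N" for i
    using that span_f[of "e - 1 - i"] span_g[of "N - 1 - i"] by (auto simp: P_def N d_def e_def)
  then obtain c where c: "\<And>i. i < N \<Longrightarrow> P i = (\<Sum>k<N. smult (c i k) (u k))"
    by metis
  define S where "S = sylvester_mat f g"
  have S: "S \<in> carrier_mat N N"
    by (auto simp: S_def N_def)
  define Te where "Te = mat e e (\<lambda>(i, j). coeff (a (e - 1 - i)) (e - 1 - j))"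
  define Td where "Td = mat d d (\<lambda>(i, j). coeff (a (d - 1 - i)) (d - 1 - j))"
  define T where "T = four_block_mat Te (0\<^sub>m e d) (0\<^sub>m d e) Td"
  define U where "U = mat N N (\<lambda>(i, j). coeff (u (N - 1 - i)) (N - 1 - j))"
  define C where "C = mat N N (\<lambda>(i, k). c i (N - 1 - k))"
  have T: "T \<in> carrier_mat N N"
    by (simp add: T_def Te_def Td_def N)
  have rev: "(\<Sum>k<n. F k) = (\<Sum>k<n. F (n - 1 - k))" for n and F :: "nat \<Rightarrow> 'a"
    by (rule sum.reindex_bij_witness[where i = "\<lambda>k. n - 1 - k" and j = "\<lambda>k. n - 1 - k"]) auto
  have "T * S = C * U"
  proof (rule eq_matI)
    fix i j assume "i < dim_row (C * U)" "j < dim_col (C * U)"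
    then have i: "i < N" and j: "j < N"
      by (simp_all add: C_def U_def)
    have "(T * S) $$ (i, j) = (\<Sum>k<N. T $$ (i, k) * S $$ (k, j))"
      using T S i j by (simp add: scalar_prod_def atLeast0LessThan)
    \<comment> \<open>Since \<open>T\<close> is block diagonal, only the half belonging to the block
      of row \<open>i\<close> survives.\<close>
    also have "\<dots> = (\<Sum>k<e. T $$ (i, k) * S $$ (k, j)) + (\<Sum>k<d. T $$ (i, e + k) * S $$ (e + k, j))"
      using sum.atLeastLessThan_concat[of 0 e N "\<lambda>k. T $$ (i, k) * S $$ (k, j)"]
        sum.shift_bounds_nat_ivl[of "\<lambda>k. T $$ (i, k) * S $$ (k, j)" 0 e d]
      by (simp add: N atLeast0LessThan add.commute)
    also have "\<dots> = coeff (P i) (N - 1 - j)"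
    proof (cases "i < e")
      case True
      have "(\<Sum>k<d. T $$ (i, e + k) * S $$ (e + k, j)) = 0"
        using True by (intro sum.neutral) (simp add: T_def Te_def Td_def)
      moreover have "(\<Sum>k<e. T $$ (i, k) * S $$ (k, j)) =
          (\<Sum>k<e. coeff (a (e - 1 - i)) (e - 1 - k) * coeff (monom 1 (e - 1 - k) * f) (N - 1 - j))"
        using True i j by (intro sum.cong)
          (auto simp: T_def Te_def Td_def S_def sylvester_mat_row_eq_coeff N_def d_def e_def)
      moreover have "\<dots> = coeff (a (e - 1 - i) * f) (N - 1 - j)"
      proof -
        have "degree (a (e - 1 - i)) < e"
          using deg_a[of "e - 1 - i"] True N by linarith
        then show ?thesis
          using rev[of "\<lambda>k. coeff (a (e - 1 - i)) k * coeff (monom 1 k * f) (N - 1 - j)" e]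
          by (simp only: coeff_mult_eq_sum_monom)
      qed
      ultimately show ?thesis
        using True by (simp add: P_def)
    next
      case False
      have "(\<Sum>k<e. T $$ (i, k) * S $$ (k, j)) = 0"
        using False i by (intro sum.neutral) (simp add: T_def Te_def Td_def N)
      moreover have "(\<Sum>k<d. T $$ (i, e + k) * S $$ (e + k, j)) =
          (\<Sum>k<d. coeff (a (N - 1 - i)) (d - 1 - k) * coeff (monom 1 (d - 1 - k) * g) (N - 1 - j))"
      proof (rule sum.cong)
        fix k assume k: "k \<in> {..<d}"
        then have "S $$ (e + k, j) = coeff (monom 1 (d - 1 - k) * g) (N - 1 - j)"
          using j by (simp add: S_def sylvester_mat_row_eq_coeff N_def d_def e_def)
        moreover have "d - Suc (i - e) = N - Suc i"
          using False i N by simp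
        then have "T $$ (i, e + k) = coeff (a (N - 1 - i)) (d - 1 - k)"
          using k False i by (simp add: T_def Te_def Td_def N)
        ultimately show "T $$ (i, e + k) * S $$ (e + k, j) =
            coeff (a (N - 1 - i)) (d - 1 - k) * coeff (monom 1 (d - 1 - k) * g) (N - 1 - j)"
          by simp
      qed simp
      moreover have "\<dots> = coeff (a (N - 1 - i) * g) (N - 1 - j)"
      proof -
        have "degree (a (N - 1 - i)) < d"
          using deg_a[of "N - 1 - i"] False i N by linarith
        then show ?thesis
          using rev[of "\<lambda>k. coeff (a (N - 1 - i)) k * coeff (monom 1 k * g) (N - 1 - j)" d]
          by (simp only: coeff_mult_eq_sum_monom)
      qed
      ultimately show ?thesis
        using False by (simp add: P_def)
    qed
    also have "\<dots> = (\<Sum>k<N. c i k * coeff (u k) (N - 1 - j))"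
      using i by (simp add: c coeff_sum)
    also have "\<dots> = (\<Sum>k<N. c i (N - 1 - k) * coeff (u (N - 1 - k)) (N - 1 - j))"
      by (rule rev)
    also have "\<dots> = (C * U) $$ (i, j)"
      using i j by (simp add: C_def U_def scalar_prod_def atLeast0LessThan)
    finally show "(T * S) $$ (i, j) = (C * U) $$ (i, j)" .
  qed (use T S in \<open>auto simp: C_def U_def\<close>)
  then have "det T * det S = det C * det U"
    using T S det_mult[of T N S] det_mult[of C N U] by (simp add: C_def U_def)
  moreover have "det T = det Te * det Td"
    unfolding T_def by (rule det_four_block_mat_upper_right_zero[of _ e _ d]) (simp_all add: Te_def Td_def)
  moreover have "det Te = (\<Prod>i<e. coeff (a i) i)"
    unfolding Te_def by (rule det_upper_triangular_reversed) (use deg_a N in auto)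
  moreover have "det Td = (\<Prod>i<d. coeff (a i) i)"
    unfolding Td_def by (rule det_upper_triangular_reversed) (use deg_a N in auto)
  moreover have "det U = (\<Prod>k<N. coeff (u k) k)"
    unfolding U_def by (rule det_upper_triangular_reversed) (use deg_u in auto)
  \<comment> \<open>The factor \<open>det C\<close> witnesses the divisibility.\<close>
  ultimately show ?thesis
    by (simp add: S_def d_def e_def resultant_def)
qed

subsection \<open>Ideals given by local exponents\<close>

text \<open>For antitone \<open>e\<close> this describes the ideal generated by all
  \<open>p ^ e j * (x - a) ^ j\<close>; composing with \<open>x + a\<close> recenters the expansion
  at \<open>a\<close>.\<close>

definition loc_dvd :: "int \<Rightarrow> (nat \<Rightarrow> nat) \<Rightarrow> int \<Rightarrow> int poly \<Rightarrow> bool" where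
  "loc_dvd p e a h \<longleftrightarrow> (\<forall>j. p ^ e j dvd coeff (h \<circ>\<^sub>p [:a, 1:]) j)"

lemma loc_dvd_mult:
  assumes "loc_dvd p e1 a h1" "loc_dvd p e2 a h2" "\<And>i j. e (i + j) \<le> e1 i + e2 j"
  shows "loc_dvd p e a (h1 * h2)"
  unfolding loc_dvd_def pcompose_mult coeff_mult
proof (intro allI dvd_sum)
  fix n i :: nat assume "i \<in> {..n}"
  then have "p ^ e n dvd p ^ e1 i * p ^ e2 (n - i)"
    using assms(3)[of i "n - i"] by (simp add: le_imp_power_dvd flip: power_add)
  also have "\<dots> dvd coeff (h1 \<circ>\<^sub>p [:a, 1:]) i * coeff (h2 \<circ>\<^sub>p [:a, 1:]) (n - i)"
    using assms(1,2) by (auto simp: loc_dvd_def intro: mult_dvd_mono)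
  finally show "p ^ e n dvd \<dots>" .
qed

lemma loc_dvd_mult_left:
  assumes "antimono e" "loc_dvd p e a h"
  shows "loc_dvd p e a (q * h)"
  by (rule loc_dvd_mult[OF _ assms(2), of "\<lambda>_. 0"])
    (use assms(1) in \<open>auto simp: loc_dvd_def antimono_def\<close>)

lemma loc_dvd_diff: "loc_dvd p e a h1 \<Longrightarrow> loc_dvd p e a h2 \<Longrightarrow> loc_dvd p e a (h1 - h2)"
  by (simp add: loc_dvd_def pcompose_diff)

lemma loc_dvd_const: "p ^ e 0 dvd c \<Longrightarrow> loc_dvd p e a [:c:]"
  by (simp add: loc_dvd_def coeff_pCons split: nat.split)

lemma pcompose_shift_linear_mult:
  fixes a b :: "'a::comm_ring_1"
  shows "([:-b, 1:] * h) \<circ>\<^sub>p [:a, 1:] = [:a - b, 1:] * (h \<circ>\<^sub>p [:a, 1:])"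
  unfolding pcompose_mult by (simp add: pcompose_pCons)

text \<open>The factor \<open>x - a\<close> shifts the expansion at \<open>a\<close> by one place
  and clears the constant coefficient, so \<open>e 0\<close> imposes no condition.\<close>

lemma loc_dvd_linear_mult_iff:
  "loc_dvd p e a ([:-a, 1:] * h) \<longleftrightarrow> loc_dvd p (\<lambda>j. e (Suc j)) a h"
  unfolding loc_dvd_def pcompose_shift_linear_mult by (auto simp: coeff_pCons split: nat.split)

text \<open>In powers of \<open>x - a\<close>, the factor \<open>x - b\<close> has constant
  coefficient \<open>a - b\<close>, which is invertible modulo powers of \<open>p\<close>. Each
  coefficient of the product is \<open>a - b\<close> times the same coefficient of \<open>h\<close>
  plus the preceding one, which induction controls because \<open>e\<close> is antitone.\<close>

lemma loc_dvd_cancel_linear: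
  assumes "prime p" "\<not> p dvd a - b" "antimono e" "loc_dvd p e a ([:-b, 1:] * h)"
  shows "loc_dvd p e a h"
proof -
  define q where "q = h \<circ>\<^sub>p [:a, 1:]"
  have dvd: "p ^ e j dvd coeff ([:a - b, 1:] * q) j" for j
    using assms(4) by (simp only: loc_dvd_def pcompose_shift_linear_mult q_def)
  have coprime: "coprime (p ^ k) (a - b)" for k
    using assms(1,2) by (simp add: prime_imp_coprime)
  have "p ^ e j dvd coeff q j" for j
  proof (induction j)
    case 0
    then show ?case
      using dvd[of 0] coprime by (simp add: coprime_dvd_mult_right_iff)
  next
    case (Suc j)
    have "p ^ e (Suc j) dvd coeff q j"
      using dvd_trans[OF le_imp_power_dvd Suc] antimonoD[OF assms(3), of j "Suc j"] by simp
    then have "p ^ e (Suc j) dvd (a - b) * coeff q (Suc j)"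
      using dvd[of "Suc j"] by (simp add: dvd_add_left_iff)
    then show ?case
      using coprime by (simp add: coprime_dvd_mult_right_iff)
  qed
  then show ?thesis
    by (simp add: loc_dvd_def q_def)
qed

text \<open>
  The basis is built greedily: the next factor is \<open>x - a\<close> for an \<open>a\<close> whose current exponent \<open>e a 0\<close>
  is largest, after which \<open>e a\<close> is shifted. In particular the exponents \<open>\<beta> k\<close> decrease, and once
  \<open>\<beta> n = 0\<close> all exponents have been used up.
\<close>

lemma exists_regular_basis:
  fixes A :: "int set" and e :: "int \<Rightarrow> nat \<Rightarrow> nat"
  assumes p: "prime p" and A: "finite A" "A \<noteq> {}" "pairwise (\<lambda>a b. \<not> p dvd a - b) A"
    and e: "\<forall>a\<in>A. antimono (e a)" "\<forall>a\<in>A. \<forall>j\<ge>K. e a j = 0"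
  shows "\<exists>u \<beta>. (\<forall>k\<le>n. degree (u k) \<le> k \<and> coeff (u k) k = p ^ \<beta> k
      \<and> (\<forall>a\<in>A. loc_dvd p (e a) a (u k)))
    \<and> (\<forall>h. degree h \<le> n \<longrightarrow> (\<forall>a\<in>A. loc_dvd p (e a) a h) \<longrightarrow> (\<exists>c. h = (\<Sum>k\<le>n. smult (c k) (u k))))
    \<and> (\<Sum>k<n. \<beta> k) \<le> (\<Sum>a\<in>A. \<Sum>j<K. e a j)
    \<and> (\<beta> n = 0 \<longrightarrow> (\<Sum>k<n. \<beta> k) = (\<Sum>a\<in>A. \<Sum>j<K. e a j))"
  using e
proof (induction n arbitrary: e)
  case (0 e)
  obtain a where a: "a \<in> A" and max: "\<And>b. b \<in> A \<Longrightarrow> e b 0 \<le> e a 0"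
    using obtains_MAX[OF A(1,2), of "\<lambda>a. e a 0"] A(1) by (metis Max_ge finite_imageI imageI)
  have const: "loc_dvd p (e b) b [:p ^ e a 0:]" if "b \<in> A" for b
    using max[OF that] by (intro loc_dvd_const le_imp_power_dvd)
  have span: "\<exists>c. h = (\<Sum>k\<le>(0::nat). smult (c k) [:p ^ e a 0:])"
    if "degree h \<le> 0" "\<forall>b\<in>A. loc_dvd p (e b) b h" for h
  proof -
    from that(1) obtain c where c: "h = [:c:]"
      by (metis degree_eq_zeroE le_zero_eq)
    have "loc_dvd p (e a) a [:c:]"
      using that(2) a c by blast
    then have "p ^ e a 0 dvd c"
      unfolding loc_dvd_def by (metis pcompose_const coeff_pCons_0)
    then obtain m where "c = p ^ e a 0 * m" ..
    then show ?thesis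
      by (intro exI[of _ "\<lambda>_. m"]) (simp add: c)
  qed
  have "e b j = 0" if "e a 0 = 0" "b \<in> A" for b j
    using that max[of b] antimonoD[of "e b" 0 j] 0(1) by simp
  then have "e a 0 = 0 \<longrightarrow> 0 = (\<Sum>b\<in>A. \<Sum>j<K. e b j)"
    by simp
  moreover have "\<forall>k\<le>(0::nat). degree [:p ^ e a 0:] \<le> k \<and> coeff [:p ^ e a 0:] k = p ^ e a 0
      \<and> (\<forall>b\<in>A. loc_dvd p (e b) b [:p ^ e a 0:])"
    using const by simp
  ultimately show ?case
    using span by (intro exI[of _ "\<lambda>_. [:p ^ e a 0:]"] exI[of _ "\<lambda>_. e a 0"] conjI allI impI) simp_all
next
  case (Suc n e)
  obtain a where a: "a \<in> A" and max: "\<And>b. b \<in> A \<Longrightarrow> e b 0 \<le> e a 0"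
    using obtains_MAX[OF A(1,2), of "\<lambda>a. e a 0"] A(1) by (metis Max_ge finite_imageI imageI)
  \<comment> \<open>Elements of the ideal that vanish at \<open>a\<close> are \<open>x - a\<close>
    times elements of the ideal given by \<open>e'\<close>, to which the induction hypothesis
    applies.\<close>
  define e' where "e' = e(a := \<lambda>j. e a (Suc j))"
  have e': "\<forall>b\<in>A. antimono (e' b)" "\<forall>b\<in>A. \<forall>j\<ge>K. e' b j = 0"
    using Suc.prems by (auto simp: e'_def antimono_def)
  obtain u \<beta> where u_all: "\<forall>k\<le>n. degree (u k) \<le> k \<and> coeff (u k) k = p ^ \<beta> k
      \<and> (\<forall>a\<in>A. loc_dvd p (e' a) a (u k))"
    and span: "\<forall>h. degree h \<le> n \<longrightarrow> (\<forall>a\<in>A. loc_dvd p (e' a) a h) \<longrightarrow>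
      (\<exists>c. h = (\<Sum>k\<le>n. smult (c k) (u k)))"
    and le: "(\<Sum>k<n. \<beta> k) \<le> (\<Sum>a\<in>A. \<Sum>j<K. e' a j)"
    and eq: "\<beta> n = 0 \<longrightarrow> (\<Sum>k<n. \<beta> k) = (\<Sum>a\<in>A. \<Sum>j<K. e' a j)"
    using Suc.IH[of e', OF e'] by (elim exE conjE) (rule that)
  have u: "degree (u k) \<le> k" "coeff (u k) k = p ^ \<beta> k" "b \<in> A \<Longrightarrow> loc_dvd p (e' b) b (u k)" if "k \<le> n" for k b
    using u_all that by blast+
  define u' where "u' k = (case k of 0 \<Rightarrow> [:p ^ e a 0:] | Suc k \<Rightarrow> [:-a, 1:] * u k)" for k
  define \<beta>' where "\<beta>' k = (case k of 0 \<Rightarrow> e a 0 | Suc k \<Rightarrow> \<beta> k)" for k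
  \<comment> \<open>As \<open>e a 0\<close> is maximal, constants divisible by
    \<open>p ^ e a 0\<close> meet the conditions at all points.\<close>
  have const: "loc_dvd p (e b) b [:c:]" if "b \<in> A" "p ^ e a 0 dvd c" for b c
    using max[OF that(1)] that(2) by (meson dvd_trans loc_dvd_const le_imp_power_dvd)
  have deg: "degree (u' k) \<le> k" "coeff (u' k) k = p ^ \<beta>' k" "\<forall>b\<in>A. loc_dvd p (e b) b (u' k)"
    if "k \<le> Suc n" for k
  proof -
    show "degree (u' k) \<le> k"
    proof (cases k)
      case (Suc m)
      have "degree ([:-a, 1:] * u m) \<le> 1 + degree (u m)"
        by (rule order.trans[OF degree_mult_le]) simp
      with Suc that u(1)[of m] show ?thesis
        by (simp add: u'_def del: mult_pCons_left)
    qed (simp add: u'_def)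
    show "coeff (u' k) k = p ^ \<beta>' k"
      using that u(1,2)[of "k - 1"] by (auto simp: u'_def \<beta>'_def coeff_eq_0 split: nat.split)
    show "\<forall>b\<in>A. loc_dvd p (e b) b (u' k)"
    proof
      fix b assume b: "b \<in> A"
      show "loc_dvd p (e b) b (u' k)"
      proof (cases k)
        case 0
        then show ?thesis
          using const[OF b] by (simp add: u'_def)
      next
        case (Suc m)
        then have um: "loc_dvd p (e' b) b (u m)"
          using u(3) b that by simp
        have "loc_dvd p (e b) b ([:-a, 1:] * u m)"
        proof (cases "b = a")
          case True
          then show ?thesis
            using um loc_dvd_linear_mult_iff[of p "e a" a "u m"] by (simp add: e'_def)
        next
          case False
          then show ?thesis
            using um Suc.prems(1) b by (intro loc_dvd_mult_left) (auto simp: e'_def)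
        qed
        then show ?thesis
          by (simp add: u'_def Suc del: mult_pCons_left)
      qed
    qed
  qed
  have span': "\<exists>c. h = (\<Sum>k\<le>Suc n. smult (c k) (u' k))"
    if h: "degree h \<le> Suc n" "\<forall>b\<in>A. loc_dvd p (e b) b h" for h
  proof -
    have "p ^ e a 0 dvd poly h a"
    proof -
      have "p ^ e a 0 dvd coeff (h \<circ>\<^sub>p [:a, 1:]) 0"
        using h(2) a by (simp only: loc_dvd_def)
      then show ?thesis
        by (simp add: coeff_pcompose_0)
    qed
    then obtain c0 where c0: "poly h a = c0 * p ^ e a 0"
      by (metis dvdE mult.commute)
    \<comment> \<open>Splitting off the value at \<open>a\<close>, which is a multiple of
      \<open>u' 0\<close>, leaves a polynomial divisible by \<open>x - a\<close>.\<close>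
    have "poly (h - [:poly h a:]) a = 0"
      by simp
    then obtain q where q: "h - [:poly h a:] = [:-a, 1:] * q"
      by (metis poly_eq_0_iff_dvd dvdE)
    have "degree q \<le> n"
    proof (cases "q = 0")
      case False
      then have "degree ([:-a, 1:] * q) = Suc (degree q)"
        by (subst degree_mult_eq) auto
      moreover have "degree (h - [:poly h a:]) \<le> Suc n"
        using h(1) by (intro degree_diff_le) auto
      ultimately show ?thesis
        using q by simp
    qed simp
    moreover have "loc_dvd p (e' b) b q" if b: "b \<in> A" for b
    proof -
      have lin: "loc_dvd p (e b) b ([:-a, 1:] * q)"
        using h(2) b const[OF b, of "poly h a"] c0 by (simp only: flip: q) (intro loc_dvd_diff; simp)
      show ?thesis
      proof (cases "b = a")
        case True
        then show ?thesis
          using lin loc_dvd_linear_mult_iff[of p "e a" a q] by (simp add: e'_def)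
      next
        case False
        then show ?thesis
          using loc_dvd_cancel_linear[OF p pairwiseD[OF A(3) b a] bspec[OF Suc.prems(1) b] lin] by (simp add: e'_def)
      qed
    qed
    ultimately obtain c where c: "q = (\<Sum>k\<le>n. smult (c k) (u k))"
      using span by blast
    have "h = [:poly h a:] + [:-a, 1:] * q"
      using q by (simp add: algebra_simps)
    also have "\<dots> = smult c0 (u' 0) + (\<Sum>k\<le>n. smult (c k) (u' (Suc k)))"
      using c0 by (simp add: c u'_def sum_distrib_left del: mult_pCons_left)
    also have "\<dots> = (\<Sum>k\<le>Suc n. smult (case k of 0 \<Rightarrow> c0 | Suc k \<Rightarrow> c k) (u' k))"
      by (simp add: sum.atMost_Suc_shift del: sum.atMost_Suc)
    finally show ?thesis
      by blast
  qed
  have "(\<Sum>j<K. e a j) = e a 0 + (\<Sum>j<K. e' a j)"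
  proof -
    \<comment> \<open>With \<open>Suc K\<close> terms the shift is exact, and the added term
      \<open>e a K\<close> is zero.\<close>
    have "(\<Sum>j<Suc K. e a j) = e a 0 + (\<Sum>j<K. e' a j)"
      by (simp add: sum.lessThan_Suc_shift e'_def del: sum.lessThan_Suc)
    then show ?thesis
      using Suc.prems(2) a by simp
  qed
  then have total: "(\<Sum>a\<in>A. \<Sum>j<K. e a j) = e a 0 + (\<Sum>a\<in>A. \<Sum>j<K. e' a j)"
    using sum.remove[OF A(1) a, of "\<lambda>a. \<Sum>j<K. e a j"] sum.remove[OF A(1) a, of "\<lambda>a. \<Sum>j<K. e' a j"]
    by (simp add: e'_def)
  have sum: "(\<Sum>k<Suc n. \<beta>' k) = e a 0 + (\<Sum>k<n. \<beta> k)"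
    by (simp add: sum.lessThan_Suc_shift \<beta>'_def del: sum.lessThan_Suc)
  have "(\<Sum>k<Suc n. \<beta>' k) = (\<Sum>a\<in>A. \<Sum>j<K. e a j)" if "\<beta>' (Suc n) = 0"
    using eq that unfolding sum total by (simp add: \<beta>'_def)
  moreover have "(\<Sum>k<Suc n. \<beta>' k) \<le> (\<Sum>a\<in>A. \<Sum>j<K. e a j)"
    using le unfolding sum total by simp
  ultimately show ?case
    using deg span' by (intro exI[of _ u'] exI[of _ \<beta>'] conjI allI impI)
qed

text \<open>Products of two elements of the ideal given by \<open>e\<close> lie in the one given by
  \<open>e'\<close>. With bases \<open>v\<close> and \<open>u\<close> of these ideals,
  \<open>prod_lead_dvd_resultant\<close> compares powers of \<open>p\<close>; the multipliers
  \<open>v i\<close> occur once with \<open>f\<close> and once with \<open>g\<close>, whence the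
  factor 2.\<close>

lemma sum_exponents_le_multiplicity_resultant:
  fixes A :: "int set" and f g :: "int poly" and e e' :: "int \<Rightarrow> nat \<Rightarrow> nat"
  assumes p: "prime p" and A: "finite A" "A \<noteq> {}" "pairwise (\<lambda>a b. \<not> p dvd a - b) A"
    and e: "\<forall>a\<in>A. antimono (e a)" "\<forall>a\<in>A. \<forall>j\<ge>K. e a j = 0"
    and e': "\<forall>a\<in>A. antimono (e' a)" "\<forall>a\<in>A. \<forall>j\<ge>K. e' a j = 0"
    and e'_le: "\<And>a i j. a \<in> A \<Longrightarrow> e' a (i + j) \<le> e a i + e a j"
    and monic: "lead_coeff f = 1" "lead_coeff g = 1" and r: "resultant f g \<noteq> 0"
    and f: "\<And>a. a \<in> A \<Longrightarrow> loc_dvd p (e a) a f" and g: "\<And>a. a \<in> A \<Longrightarrow> loc_dvd p (e a) a g"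
  shows "(\<Sum>a\<in>A. \<Sum>j<K. e' a j) \<le> multiplicity p (resultant f g) + 2 * (\<Sum>a\<in>A. \<Sum>j<K. e a j)"
proof -
  define N where "N = degree f + degree g"
  have "\<exists>v \<alpha>. (\<forall>k\<le>N. degree (v k) \<le> k \<and> coeff (v k) k = p ^ \<alpha> k \<and> (\<forall>a\<in>A. loc_dvd p (e a) a (v k)))
      \<and> (\<Sum>k<N. \<alpha> k) \<le> (\<Sum>a\<in>A. \<Sum>j<K. e a j)"
    using exists_regular_basis[OF p A e, of N] by blast
  then obtain v \<alpha> where v: "\<And>k. k \<le> N \<Longrightarrow> degree (v k) \<le> k" "\<And>k. k \<le> N \<Longrightarrow> coeff (v k) k = p ^ \<alpha> k"
      "\<And>k a. k \<le> N \<Longrightarrow> a \<in> A \<Longrightarrow> loc_dvd p (e a) a (v k)"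
    and \<alpha>: "(\<Sum>k<N. \<alpha> k) \<le> (\<Sum>a\<in>A. \<Sum>j<K. e a j)"
    by auto
  obtain u \<beta> where u_all: "\<forall>k\<le>N. degree (u k) \<le> k \<and> coeff (u k) k = p ^ \<beta> k
      \<and> (\<forall>a\<in>A. loc_dvd p (e' a) a (u k))"
    and span: "\<forall>h. degree h \<le> N \<longrightarrow> (\<forall>a\<in>A. loc_dvd p (e' a) a h) \<longrightarrow>
      (\<exists>c. h = (\<Sum>k\<le>N. smult (c k) (u k)))"
    and \<beta>: "\<beta> N = 0 \<longrightarrow> (\<Sum>k<N. \<beta> k) = (\<Sum>a\<in>A. \<Sum>j<K. e' a j)"
    using exists_regular_basis[OF p A e', of N] by (elim exE conjE) (rule that)
  have u: "degree (u k) \<le> k" "coeff (u k) k = p ^ \<beta> k" if "k \<le> N" for k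
    using u_all that by blast+
  have coeff_N: "coeff (\<Sum>k\<le>N. smult (c k) (u k)) N = c N * p ^ \<beta> N" for c
  proof -
    have "coeff (u k) N = 0" if "k < N" for k
      using u(1)[of k] that by (intro coeff_eq_0) simp
    then have "(\<Sum>k<N. c k * coeff (u k) N) = 0"
      by (intro sum.neutral) simp
    then show ?thesis
      using u(2)[of N] by (simp add: coeff_sum flip: lessThan_Suc_atMost)
  qed
  have prod: "loc_dvd p (e' a) a (h1 * h2)" if "a \<in> A" "loc_dvd p (e a) a h1" "loc_dvd p (e a) a h2" for a h1 h2
    using that(2,3) e'_le[OF that(1)] by (rule loc_dvd_mult)

  \<comment> \<open>\<open>f * g\<close> is a monic element of degree \<open>N\<close> of the span of the \<open>u k\<close>, which forces \<open>\<beta> N = 0\<close>.\<close>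
  have "degree (f * g) = N"
    using monic by (simp add: N_def degree_mult_eq_0 degree_mult_eq flip: leading_coeff_0_iff)
  moreover from this have "coeff (f * g) N = 1"
    using monic lead_coeff_mult[of f g] by simp
  moreover obtain c where "f * g = (\<Sum>k\<le>N. smult (c k) (u k))"
    using span prod f g \<open>degree (f * g) = N\<close> by blast
  ultimately have "p ^ \<beta> N dvd 1"
    using coeff_N[of c] by (metis dvd_triv_right)
  then have "\<beta> N = 0"
    using p by (metis is_unit_power_iff not_prime_unit)

  \<comment> \<open>Among the \<open>u k\<close> with \<open>k \<le> N\<close> only
    \<open>u N\<close> has a nonzero coefficient at \<open>N\<close>, so it cannot occur in lower
    degree.\<close>
  have span_lt: "\<exists>c. h = (\<Sum>k<N. smult (c k) (u k))"
    if h: "degree h < N" "\<forall>a\<in>A. loc_dvd p (e' a) a h" for h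
  proof -
    obtain c where c: "h = (\<Sum>k\<le>N. smult (c k) (u k))"
      using span h by (meson less_imp_le)
    moreover have "c N * p ^ \<beta> N = 0"
      using coeff_N[of c] c h(1) by (simp add: coeff_eq_0)
    then have "c N = 0"
      using p by auto
    ultimately show ?thesis
      by (auto simp flip: lessThan_Suc_atMost)
  qed
  have "(\<Prod>k<N. coeff (u k) k) dvd
      (\<Prod>i<degree g. coeff (v i) i) * (\<Prod>i<degree f. coeff (v i) i) * resultant f g"
    unfolding N_def
  proof (rule prod_lead_dvd_resultant; fold N_def)
    fix i assume "i < degree g"
    then show "\<exists>c. v i * f = (\<Sum>k<N. smult (c k) (u k))"
      using v(1,3)[of i] f prod degree_mult_le[of "v i" f] by (intro span_lt) (auto simp: N_def)
  next
    fix i assume "i < degree f"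
    then show "\<exists>c. v i * g = (\<Sum>k<N. smult (c k) (u k))"
      using v(1,3)[of i] g prod degree_mult_le[of "v i" g] by (intro span_lt) (auto simp: N_def)
  qed (use u v in auto)
  moreover have "(\<Prod>k<N. coeff (u k) k) = p ^ (\<Sum>k<N. \<beta> k)"
    by (simp add: u power_sum)
  moreover have "(\<Prod>i<n. coeff (v i) i) = p ^ (\<Sum>i<n. \<alpha> i)" if "n \<le> N" for n
    using that by (simp add: v power_sum)
  ultimately have "p ^ (\<Sum>k<N. \<beta> k) dvd p ^ ((\<Sum>i<degree g. \<alpha> i) + (\<Sum>i<degree f. \<alpha> i)) * resultant f g"
    by (simp add: N_def power_add)
  moreover have "p ^ ((\<Sum>i<degree g. \<alpha> i) + (\<Sum>i<degree f. \<alpha> i)) * resultant f g \<noteq> 0"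
    using r p by auto
  ultimately have "(\<Sum>k<N. \<beta> k) \<le>
      multiplicity p (p ^ ((\<Sum>i<degree g. \<alpha> i) + (\<Sum>i<degree f. \<alpha> i)) * resultant f g)"
    using p by (subst (asm) power_dvd_iff_le_multiplicity) auto
  also have "\<dots> = (\<Sum>i<degree g. \<alpha> i) + (\<Sum>i<degree f. \<alpha> i) + multiplicity p (resultant f g)"
    using p r by (subst prime_elem_multiplicity_mult_distrib) (auto intro: multiplicity_same_power)
  also have "\<dots> \<le> (\<Sum>i<N. \<alpha> i) + (\<Sum>i<N. \<alpha> i) + multiplicity p (resultant f g)"
    by (intro add_mono sum_mono2) (auto simp: N_def)
  finally show ?thesis
    using \<alpha> \<beta> \<open>\<beta> N = 0\<close> by simp
qed

subsection \<open>Polynomials whose values are divisible by a prime power\<close>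

text \<open>This is the bound on the number of roots over the field with \<open>p\<close> elements,
  proved over the integers by splitting off one point of \<open>A\<close> at a time.\<close>

lemma prime_dvd_poly_of_dvd_values:
  fixes q :: "int poly"
  assumes p: "prime p" and "finite A" "pairwise (\<lambda>a b. \<not> p dvd a - b) A"
    and "degree q < card A" "\<forall>a\<in>A. p dvd poly q a"
  shows "[:p:] dvd q"
  using assms(2-)
proof (induction A arbitrary: q rule: finite_induct)
  case (insert a A q)
  have "poly (q - [:poly q a:]) a = 0"
    by simp
  then obtain q' where "q - [:poly q a:] = [:-a, 1:] * q'"
    by (metis poly_eq_0_iff_dvd dvdE)
  then have q: "q = [:poly q a:] + [:-a, 1:] * q'"
    by (metis add.commute diff_add_cancel)
  have "[:p:] dvd q'"
  proof (cases "q' = 0")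
    case False
    have "Suc (degree q') = degree ([:-a, 1:] * q')"
      using False by (subst degree_mult_eq) auto
    also have "\<dots> \<le> degree q"
      using \<open>q - _ = _\<close> by (metis degree_diff_le degree_pCons_0 le0 order_refl)
    finally have "degree q' < card A"
      using insert.prems(2) insert.hyps by simp
    moreover have "p dvd poly q' b" if "b \<in> A" for b
    proof -
      have "(b - a) * poly q' b = poly q b - poly q a"
        by (subst (1) q) (simp add: algebra_simps)
      then have "p dvd (b - a) * poly q' b"
        using insert.prems(3) that by simp
      moreover have "\<not> p dvd b - a"
        using insert.prems(1) insert.hyps that by (auto simp: pairwise_def)
      ultimately show ?thesis
        using p by (simp add: prime_dvd_mult_iff)
    qed
    ultimately show ?thesis
      using insert.IH insert.prems(1) by (simp add: pairwise_insert)
  qed simp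
  moreover have "[:p:] dvd [:poly q a:]"
    using insert.prems(3) by simp
  ultimately show ?case
    by (subst q) (intro dvd_add dvd_mult)
qed simp

lemma pairwise_incongruent_interval:
  fixes n p :: int
  shows "pairwise (\<lambda>a b. \<not> p dvd a - b) {n..<n + p}"
proof (rule pairwiseI, rule notI)
  fix a b assume ab: "a \<in> {n..<n + p}" "b \<in> {n..<n + p}" "a \<noteq> b" and "p dvd a - b"
  then have "\<bar>p\<bar> \<le> \<bar>a - b\<bar>"
    by (intro dvd_imp_le_int) auto
  then show False
    using ab by auto
qed

text \<open>Put \<open>h(y) = f(a + p * y)\<close>, whose coefficients are \<open>p ^ j\<close>
  times those of \<open>f\<close> at \<open>a\<close>. Powers of \<open>p\<close> up to
  \<open>p ^ s\<close> are extracted from \<open>h\<close> one by one: modulo \<open>p\<close> the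
  remaining cofactor has degree below \<open>p\<close> and vanishes at all residues, hence is
  zero.\<close>

lemma power_dvd_coeff_shift:
  fixes f :: "int poly" and p s :: nat
  assumes p: "prime p" and "s \<le> p" and f: "\<And>n. int p ^ s dvd poly f n"
  shows "int p ^ (s - j) dvd coeff (f \<circ>\<^sub>p [:a, 1:]) j"
proof (cases "j < s")
  case True
  define h where "h = f \<circ>\<^sub>p [:a, 1:] \<circ>\<^sub>p [:0, int p:]"
  have coeff_h: "coeff h k = int p ^ k * coeff (f \<circ>\<^sub>p [:a, 1:]) k" for k
    by (simp add: h_def coeff_pcompose_linear)
  have values_h: "int p ^ s dvd poly h n" for n
    by (simp add: h_def poly_pcompose f)
  have "[:int p ^ t:] dvd h" if "t \<le> s" for t
    using that
  proof (induction t)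
    case (Suc t)
    then obtain h' where h': "h = [:int p ^ t:] * h'"
      by (auto elim: dvdE)
    define q where "q = poly_cutoff p h'"
    have "[:int p:] dvd h' - q"
      unfolding const_poly_dvd_iff
    proof
      fix k
      have "int p dvd coeff h' k" if "k \<ge> p"
      proof -
        \<comment> \<open>Here \<open>k \<ge> p \<ge> s > t\<close>, and \<open>p ^ k\<close>
          divides the coefficient of \<open>h\<close>.\<close>
        have "int p ^ Suc t dvd int p ^ k"
          using that Suc.prems \<open>s \<le> p\<close> by (intro le_imp_power_dvd) simp
        then have "int p ^ t * int p dvd int p ^ t * coeff h' k"
          using coeff_h[of k] h' by (simp add: mult.commute)
        then show ?thesis
          using p by auto
      qed
      then show "int p dvd coeff (h' - q) k"
        by (auto simp: q_def coeff_poly_cutoff)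
    qed
    moreover have "[:int p:] dvd q"
    proof (rule prime_dvd_poly_of_dvd_values)
      show "degree q < card {0..<int p}"
        using p by (auto simp: q_def coeff_poly_cutoff prime_gt_0_nat intro: degree_lessI)
      show "\<forall>n\<in>{0..<int p}. int p dvd poly q n"
      proof
        fix n
        have "int p ^ Suc t dvd poly h n"
          using values_h[of n] Suc.prems by (meson dvd_trans le_imp_power_dvd)
        then have "int p dvd poly h' n"
          using p h' by (auto simp: mult.commute[of "int p"])
        moreover have "int p dvd poly (h' - q) n"
        proof -
          obtain k where "h' - q = [:int p:] * k"
            using \<open>[:int p:] dvd h' - q\<close> by (rule dvdE)
          then show ?thesis
            by (simp only: poly_mult) simp
        qed
        ultimately show "int p dvd poly q n"
          by (simp add: dvd_diff_right_iff)
      qed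
    qed (use p pairwise_incongruent_interval[of "int p" 0] in simp_all)
    ultimately have "[:int p:] dvd h'"
      using dvd_add[of "[:int p:]" "h' - q" q] by simp
    then show ?case
      using mult_dvd_mono[of "[:int p ^ t:]" "[:int p ^ t:]" "[:int p:]" h'] h' by (simp add: mult.commute)
  qed (simp add: const_poly_dvd_iff)
  from this[of s] have "int p ^ s dvd int p ^ j * coeff (f \<circ>\<^sub>p [:a, 1:]) j"
    by (simp add: const_poly_dvd_iff flip: coeff_h)
  moreover have "int p ^ s = int p ^ j * int p ^ (s - j)"
    using True by (simp flip: power_add)
  ultimately show ?thesis
    using p by auto
qed simp

section \<open>The bound in terms of constant and linear coefficients\<close>

lemma double_sum_truncated_diff:
  fixes n K :: nat
  assumes "n \<le> K"
  shows "2 * (\<Sum>j<K. n - j) = n * (n + 1)"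
proof -
  have "(\<Sum>j<K. n - j) = (\<Sum>j<n. n - j)"
    using assms by (intro sum.mono_neutral_right) auto
  also have "\<dots> = (\<Sum>j<n. Suc j)"
    by (rule sum.reindex_bij_witness[where i = "\<lambda>j. n - 1 - j" and j = "\<lambda>j. n - 1 - j"]) auto
  also have "2 * \<dots> = n * (n + 1)"
    by (induction n) auto
  finally show ?thesis .
qed

text \<open>
  In the residue class of \<open>a\<close>, the exponents \<open>V a, m a, s - 2, s - 3, \<dots>, 0\<close> bound the
  coefficients of \<open>f\<close> and \<open>g\<close> in powers of \<open>x - a\<close>, and \<open>2 V a, V a + m a, 2 m a, 2 s - 3, 2 s - 4, \<dots>, 0\<close>
  those of their products. All subtractions are truncated.
\<close>

lemma sum_le_multiplicity_resultant:
  fixes p s :: nat and f g :: "int poly" and V m :: "int \<Rightarrow> nat" and n0 :: int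
  defines "A \<equiv> {n0..<n0 + int p}"
  assumes p: "prime p" and monic: "lead_coeff f = 1" "lead_coeff g = 1" and r: "resultant f g \<noteq> 0"
    and s: "s \<le> p" "\<And>n. int p ^ s dvd poly f n" "\<And>n. int p ^ s dvd poly g n"
    and V: "\<And>a. a \<in> A \<Longrightarrow> int p ^ V a dvd poly f a" "\<And>a. a \<in> A \<Longrightarrow> int p ^ V a dvd poly g a"
    and m: "\<And>a. a \<in> A \<Longrightarrow> int p ^ m a dvd coeff (f \<circ>\<^sub>p [:a, 1:]) 1"
      "\<And>a. a \<in> A \<Longrightarrow> int p ^ m a dvd coeff (g \<circ>\<^sub>p [:a, 1:]) 1"
    and le: "\<And>a. a \<in> A \<Longrightarrow> s \<le> V a" "\<And>a. a \<in> A \<Longrightarrow> s - 1 \<le> m a" "\<And>a. a \<in> A \<Longrightarrow> m a \<le> V a"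
      "\<And>a. a \<in> A \<Longrightarrow> 2 * m a \<le> V a + (s - 2)"
  shows "(\<Sum>a\<in>A. V a + m a + (s - 1)\<^sup>2) \<le> multiplicity (int p) (resultant f g)"
proof -
  define e where "e a j = (if j = 0 then V a else if j = 1 then m a else s - j)" for a and j :: nat
  define e' where "e' a j = (if j = 0 then 2 * V a else if j = 1 then V a + m a else if j = 2 then 2 * m a
    else 2 * s - j)" for a and j :: nat
  \<comment> \<open>All exponents vanish from \<open>K\<close> on, and peeling off the three
    irregular ones of \<open>e'\<close> leaves \<open>2 * s\<close> terms.\<close>
  define K where "K = Suc (Suc (Suc (2 * s)))"
  have loc: "loc_dvd (int p) (e a) a h"
    if "int p ^ V a dvd poly h a" "int p ^ m a dvd coeff (h \<circ>\<^sub>p [:a, 1:]) 1" "\<And>n. int p ^ s dvd poly h n" for a h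
    using that power_dvd_coeff_shift[OF p s(1) that(3)]
    by (auto simp: loc_dvd_def e_def coeff_pcompose_0)
  have A: "finite A" "A \<noteq> {}"
    using p by (auto simp: A_def prime_gt_0_nat)
  have "(\<Sum>a\<in>A. \<Sum>j<K. e' a j) \<le> multiplicity (int p) (resultant f g) + 2 * (\<Sum>a\<in>A. \<Sum>j<K. e a j)"
  proof (rule sum_exponents_le_multiplicity_resultant)
    show "pairwise (\<lambda>a b. \<not> int p dvd a - b) A"
      unfolding A_def by (rule pairwise_incongruent_interval)
    show "\<forall>a\<in>A. antimono (e a)"
    proof
      fix a assume "a \<in> A"
      from le[OF this] show "antimono (e a)"
        by (auto simp: antimono_def e_def)
    qed
    show "\<forall>a\<in>A. antimono (e' a)"
    proof
      fix a assume "a \<in> A"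
      from le[OF this] show "antimono (e' a)"
        by (auto simp: antimono_def e'_def)
    qed
    \<comment> \<open>The indices 0 and 2 call for \<open>2 * m a \<le> V a + (s - 2)\<close>; the
      other cases follow from the lower bounds on \<open>V a\<close> and \<open>m a\<close>.\<close>
    show "e' a (i + j) \<le> e a i + e a j" if "a \<in> A" for a i j
      using le[OF that] by (auto simp: e_def e'_def)
    show "loc_dvd (int p) (e a) a f" "loc_dvd (int p) (e a) a g" if "a \<in> A" for a
      using that V m s(2,3) by (auto intro!: loc)
  qed (use p A monic r in \<open>auto simp: e_def e'_def K_def\<close>)
  moreover have "(\<Sum>j<K. e' a j) = V a + m a + (s - 1)\<^sup>2 + 2 * (\<Sum>j<K. e a j)" for a
  proof -
    define X where "X = (\<Sum>j<2 * s. 2 * s - 3 - j)"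
    define Y where "Y = (\<Sum>j<Suc (2 * s). s - 2 - j)"
    have "(\<Sum>j<K. e a j) = V a + m a + Y"
      unfolding K_def Y_def sum.lessThan_Suc_shift
      by (simp add: e_def sum.lessThan_Suc_shift del: sum.lessThan_Suc)
    moreover have "(\<Sum>j<K. e' a j) = 2 * V a + (V a + m a) + 2 * m a + X"
      unfolding K_def X_def sum.lessThan_Suc_shift by (simp add: e'_def) (intro sum.cong, auto)
    moreover have "2 * X = (2 * s - 3) * (2 * s - 3 + 1)"
      unfolding X_def by (rule double_sum_truncated_diff) simp
    moreover have "2 * Y = (s - 2) * (s - 2 + 1)"
      unfolding Y_def by (rule double_sum_truncated_diff) simp
    \<comment> \<open>This says \<open>X = 2 * Y + (s - 1)^2\<close>; for \<open>s < 2\<close>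
      truncation makes both sides zero.\<close>
    moreover have "(2 * s - 3) * (2 * s - 3 + 1) = 2 * ((s - 2) * (s - 2 + 1) + (s - 1)\<^sup>2)"
    proof (cases "s < 2")
      case False
      then obtain k where "s = Suc (Suc k)"
        by (metis add_2_eq_Suc le_Suc_ex not_less)
      then show ?thesis
        by (simp add: power2_eq_square algebra_simps)
    qed (auto simp: less_2_cases_iff)
    ultimately show ?thesis
      by presburger
  qed
  ultimately show ?thesis
    by (simp add: sum.distrib sum_distrib_left)
qed

section \<open>Values near a maximum and the equality case\<close>

text \<open>The Taylor term of order \<open>j \<ge> 2\<close> at \<open>a\<close> is divisible by
  \<open>p ^ ((s - j) + k * j)\<close>. For \<open>j = 2\<close> this exponent is at least
  \<open>t + 1\<close> because \<open>s < t\<close>; each further order loses at most 1 in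
  \<open>s - j\<close> and gains \<open>k \<ge> 1\<close>.\<close>

lemma power_dvd_poly_minus_linear_term:
  fixes h :: "int poly" and p a :: int and s t k :: nat
  defines "c \<equiv> \<lambda>j. coeff (h \<circ>\<^sub>p [:a, 1:]) j"
  assumes "s < t" and k: "k = t - (s - 1)"
    and h: "p ^ Suc t dvd poly h a" and c: "\<And>j. p ^ (s - j) dvd c j"
  shows "p ^ Suc t dvd poly h (a + p ^ k) - c 1 * p ^ k"
proof -
  obtain q where q: "h \<circ>\<^sub>p [:a, 1:] = pCons (c 0) (pCons (c 1) q)"
    by (metis One_nat_def c_def coeff_pCons_0 coeff_pCons_Suc pCons_cases)
  have coeff_q: "c (Suc (Suc j)) = coeff q j" for j
    by (subst c_def, subst q) simp
  have "poly h (a + p ^ k) = poly (h \<circ>\<^sub>p [:a, 1:]) (p ^ k)"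
    by (simp add: poly_pcompose)
  then have "poly h (a + p ^ k) - c 1 * p ^ k = poly h a + (p ^ k)\<^sup>2 * poly q (p ^ k)"
    by (simp add: q power2_eq_square algebra_simps) (simp add: c_def coeff_pcompose_0)
  moreover have "p ^ Suc t dvd (p ^ k)\<^sup>2 * poly q (p ^ k)"
    unfolding poly_altdef sum_distrib_left
  proof (rule dvd_sum)
    fix j
    have "1 \<le> k"
      using assms(2) k by linarith
    then have "j \<le> k * j"
      by simp
    then have "Suc t \<le> 2 * k + (s - Suc (Suc j)) + k * j"
      using assms(2) k by linarith
    then have "p ^ Suc t dvd p ^ (2 * k + (s - Suc (Suc j)) + k * j)"
      by (rule le_imp_power_dvd)
    also have "\<dots> = (p ^ k)\<^sup>2 * (p ^ (s - Suc (Suc j)) * (p ^ k) ^ j)"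
      by (simp only: mult.commute[of 2 k] power_add power_mult mult.assoc)
    also have "\<dots> dvd (p ^ k)\<^sup>2 * (coeff q j * (p ^ k) ^ j)"
      using c[of "Suc (Suc j)"] by (intro mult_dvd_mono) (simp_all add: coeff_q)
    finally show "p ^ Suc t dvd \<dots>" .
  qed
  ultimately show ?thesis
    using h by (simp add: dvd_add)
qed

theorem theorem6:
  fixes p s :: nat and f g :: "int poly"
  assumes "prime p"
    and "lead_coeff f = 1" and "lead_coeff g = 1"
    and "resultant f g \<noteq> 0"
    and "s \<le> p"
    and "\<forall>n :: int. int p ^ s dvd poly f n \<and> int p ^ s dvd poly g n"
  shows "int (multiplicity (int p) (resultant f g)) - int (max_gcd_val p f g)
           \<ge> int p * int s ^ 2 - int s
       \<and> (int (multiplicity (int p) (resultant f g)) - int (max_gcd_val p f g)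
           = int p * int s ^ 2 - int s
         \<longrightarrow> {s..max_gcd_val p f g} \<subseteq> range (gcd_val p f g))"
proof -
  define V where "V = gcd_val p f g"
  define S where "S = max_gcd_val p f g"
  define v where "v = multiplicity (int p) (resultant f g)"
  have fg: "int p ^ s dvd poly f n" "int p ^ s dvd poly g n" for n
    using assms(6) by auto
  have V_dvd: "int p ^ V n dvd poly f n" "int p ^ V n dvd poly g n" for n
    using multiplicity_dvd[of "int p" "gcd (poly f n) (poly g n)"] by (auto simp: V_def gcd_val_def)
  have V_ge: "k \<le> V n" if "int p ^ k dvd poly f n" "int p ^ k dvd poly g n" for k n
    unfolding V_def gcd_val_def
    using that gcd_poly_nonzero[OF assms(2-4)] assms(1) by (intro multiplicity_geI) auto
  have "S \<in> range V"
    unfolding S_def V_def max_gcd_val_def by (intro Max_in finite_range_gcd_val assms) auto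
  then obtain n0 where n0: "V n0 = S"
    by auto
  define A where "A = {n0..<n0 + int p}"
  \<comment> \<open>Since \<open>p \<ge> 2\<close>, the system \<open>A\<close> contains a second
    class, that of \<open>n0 + 1\<close>.\<close>
  have A: "finite A" "n0 \<in> A" "n0 + 1 \<in> A" "card A = p"
    using prime_ge_2_nat[OF assms(1)] by (auto simp: A_def)

  have bound: "p * s\<^sup>2 + (\<Sum>a\<in>A. (V a - s) + (m a - (s - 1))) \<le> v"
    if "\<And>a. a \<in> A \<Longrightarrow> int p ^ m a dvd coeff (f \<circ>\<^sub>p [:a, 1:]) 1"
      "\<And>a. a \<in> A \<Longrightarrow> int p ^ m a dvd coeff (g \<circ>\<^sub>p [:a, 1:]) 1"
      "\<And>a. a \<in> A \<Longrightarrow> s - 1 \<le> m a" "\<And>a. a \<in> A \<Longrightarrow> m a \<le> V a" "\<And>a. a \<in> A \<Longrightarrow> 2 * m a \<le> V a + (s - 2)"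
    for m
  proof -
    \<comment> \<open>This separates \<open>p * s^2\<close> from the excesses of \<open>V\<close>
      over \<open>s\<close> and of \<open>m\<close> over \<open>s - 1\<close>.\<close>
    have square: "s\<^sup>2 = s + (s - 1) + (s - 1)\<^sup>2"
      by (cases s) (auto simp: power2_eq_square)
    have "(\<Sum>a\<in>A. V a + m a + (s - 1)\<^sup>2) \<le> v"
      unfolding v_def A_def
      by (rule sum_le_multiplicity_resultant[where s = s]) (use assms(1-5) fg V_dvd V_ge that in \<open>auto simp: A_def\<close>)
    moreover have "(\<Sum>a\<in>A. V a + m a + (s - 1)\<^sup>2) = (\<Sum>a\<in>A. s\<^sup>2 + ((V a - s) + (m a - (s - 1))))"
    proof (rule sum.cong)
      fix a assume "a \<in> A"
      show "V a + m a + (s - 1)\<^sup>2 = s\<^sup>2 + ((V a - s) + (m a - (s - 1)))"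
        using V_ge[OF fg, of a] that(3)[OF \<open>a \<in> A\<close>] unfolding square by linarith
    qed simp
    ultimately show ?thesis
      using A(4) by (simp add: sum.distrib)
  qed
  have m: "int p ^ (s - 1) dvd coeff (f \<circ>\<^sub>p [:a, 1:]) 1" "int p ^ (s - 1) dvd coeff (g \<circ>\<^sub>p [:a, 1:]) 1" for a
    using power_dvd_coeff_shift[OF assms(1,5) fg(1)] power_dvd_coeff_shift[OF assms(1,5) fg(2)] by blast+
  have V_ge_s: "s \<le> V a" for a
    using V_ge[OF fg] .
  \<comment> \<open>The exponent \<open>s - 1\<close>, guaranteed for every linear coefficient,
    suffices for part (a).\<close>
  have "p * s\<^sup>2 + (\<Sum>a\<in>A. (V a - s) + ((s - 1) - (s - 1))) \<le> v"
  proof (rule bound)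
    fix a
    show "s - 1 \<le> V a" "2 * (s - 1) \<le> V a + (s - 2)"
      using V_ge_s[of a] by linarith+
  qed (use m in auto)
  then have bound0: "p * s\<^sup>2 + (\<Sum>a\<in>A. V a - s) \<le> v"
    by simp
  have "V n0 - s \<le> (\<Sum>a\<in>A. V a - s)"
    using A by (intro member_le_sum) auto
  then have ineq: "p * s\<^sup>2 + (S - s) \<le> v"
    using bound0 n0 by simp
  have "s \<le> S"
    using V_ge_s n0 by metis
  have attained: "t \<in> range V" if eq: "v = p * s\<^sup>2 + (S - s)" and t: "s \<le> t" "t \<le> S" for t
  proof -
    consider "t = S" | "t = s" "s < S" | "s < t" "t < S"
      using t by linarith
    then show ?thesis
    proof cases
      case 1
      then show ?thesis
        using n0 by auto
    next
      case 2
      \<comment> \<open>In the equality case \<open>n0\<close> uses up the whole excess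
        \<open>S - s\<close>, so \<open>V\<close> is minimal at \<open>n0 + 1\<close>.\<close>
      have "(\<Sum>a\<in>{n0, n0 + 1}. V a - s) \<le> (\<Sum>a\<in>A. V a - s)"
        using A by (intro sum_mono2) auto
      then have "V (n0 + 1) = s"
        using bound0 eq n0 V_ge_s[of "n0 + 1"] by simp
      then show ?thesis
        using 2 by auto
    next
      case 3
      show ?thesis
      proof (rule ccontr)
        assume "t \<notin> range V"
        \<comment> \<open>The choice gives \<open>p ^ (s - 1) * p ^ k = p ^ t\<close>, hence
          \<open>V n \<ge> t\<close>; as \<open>t\<close> is omitted,
          \<open>V n \<ge> t + 1\<close>, which forces another factor \<open>p\<close> in the linear
          coefficients.\<close>
        define k where "k = t - (s - 1)"
        define n where "n = n0 + int p ^ k"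
        have lin: "int p ^ Suc t dvd poly h n - coeff (h \<circ>\<^sub>p [:n0, 1:]) 1 * int p ^ k"
          if "int p ^ V n0 dvd poly h n0" "\<And>n. int p ^ s dvd poly h n" for h
          unfolding n_def
        proof (rule power_dvd_poly_minus_linear_term[OF 3(1) k_def])
          show "int p ^ Suc t dvd poly h n0"
            using 3(2) n0 by (intro dvd_trans[OF le_imp_power_dvd that(1)]) simp
          show "int p ^ (s - j) dvd coeff (h \<circ>\<^sub>p [:n0, 1:]) j" for j
            by (rule power_dvd_coeff_shift[OF assms(1,5) that(2)])
        qed
        have "t = (s - 1) + k"
          using 3 by (simp add: k_def)
        then have pow: "int p ^ t = int p ^ (s - 1) * int p ^ k" "int p ^ Suc t = int p ^ Suc (s - 1) * int p ^ k"
          by (simp_all add: power_add)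
        have "int p ^ t dvd poly h n"
          if "int p ^ Suc t dvd poly h n - c * int p ^ k" "int p ^ (s - 1) dvd c" for h c
        proof -
          have "int p ^ t dvd c * int p ^ k"
            using that(2) by (simp add: pow(1))
          moreover have "int p ^ t dvd poly h n - c * int p ^ k"
            using that(1) by (rule power_le_dvd) simp
          ultimately show ?thesis
            by (metis diff_add_cancel dvd_add)
        qed
        then have "t \<le> V n"
          using lin[OF V_dvd(1) fg(1)] lin[OF V_dvd(2) fg(2)] m by (intro V_ge) blast+
        then have "Suc t \<le> V n"
          using \<open>t \<notin> range V\<close> by (metis Suc_leI le_neq_implies_less rangeI)
        then have dvd_n: "int p ^ Suc t dvd poly f n" "int p ^ Suc t dvd poly g n"
          using V_dvd by (meson power_le_dvd)+
        have c_dvd: "int p ^ Suc (s - 1) dvd c"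
          if "int p ^ Suc t dvd poly h n - c * int p ^ k" "int p ^ Suc t dvd poly h n" for h c
        proof -
          have "int p ^ Suc t dvd c * int p ^ k"
            using dvd_diff[OF that(2,1)] by simp
          then show ?thesis
            unfolding pow(2) using assms(1) by (simp only: dvd_mult_cancel_right) auto
        qed
        \<comment> \<open>The exponent \<open>Suc (s - 1)\<close> is \<open>s\<close> for positive
          \<open>s\<close> and 1 for \<open>s = 0\<close>.\<close>
        define m' where "m' = (\<lambda>_. s - 1)(n0 := Suc (s - 1))"
        have "p * s\<^sup>2 + (\<Sum>a\<in>A. (V a - s) + (m' a - (s - 1))) \<le> v"
        proof (rule bound)
          fix a assume "a \<in> A"
          show "int p ^ m' a dvd coeff (f \<circ>\<^sub>p [:a, 1:]) 1"
            using m(1) c_dvd[OF lin[OF V_dvd(1) fg(1)] dvd_n(1)] by (simp add: m'_def)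
          show "int p ^ m' a dvd coeff (g \<circ>\<^sub>p [:a, 1:]) 1"
            using m(2) c_dvd[OF lin[OF V_dvd(2) fg(2)] dvd_n(2)] by (simp add: m'_def)
          \<comment> \<open>From \<open>s < t < S\<close> follows \<open>S \<ge> s + 2\<close>,
            enough for the last inequality at \<open>n0\<close>.\<close>
          show "s - 1 \<le> m' a" "m' a \<le> V a" "2 * m' a \<le> V a + (s - 2)"
            using V_ge_s[of a] n0 3 by (auto simp: m'_def)
        qed
        \<comment> \<open>The point \<open>n0\<close> alone now contributes
          \<open>S - s + 1\<close>, one more than equality permits.\<close>
        moreover have "(V n0 - s) + (m' n0 - (s - 1)) \<le> (\<Sum>a\<in>A. (V a - s) + (m' a - (s - 1)))"
          using A by (intro member_le_sum) auto
        ultimately show False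
          using eq n0 by (simp add: m'_def)
      qed
    qed
  qed
  have int_eq: "int (p * s\<^sup>2 + (S - s)) = int p * int s ^ 2 - int s + int S"
    using \<open>s \<le> S\<close> by (simp add: of_nat_diff)
  have "int p * int s ^ 2 - int s \<le> int v - int S"
    using ineq int_eq by linarith
  moreover have "v = p * s\<^sup>2 + (S - s)" if "int v - int S = int p * int s ^ 2 - int s"
    using that int_eq by linarith
  ultimately show ?thesis
    using attained unfolding v_def S_def V_def by auto
qed

end
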